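(* Let $G$ be a finite nilpotent group and let $0<\epsilon<1$. Let $\varphi_k(G)$ denote the probability that $k$ elements $g_1,\ldots,g_k$, sampled uniformly and independently with replacement from $G$, generate the entire group $G$. Then the following hold: (i) $\varphi_k(G)\ge 1-\epsilon$ for every integer $k\ge \operatorname{rank}(G)+\left\lceil \log_2\frac{2}{\epsilon}\right\rceil$; (ii) $\varphi_k(G)\ge 1-\epsilon$ for every integer $k\ge \operatorname{len}(G)+\left\lceil \log_2\frac{1}{\epsilon}\right\rceil$.
   Context: For a finite group $G$ and an integer $k\ge 0$, $\varphi_k(G)=N_k(G)/|G|^k$, where $N_k(G)$ is the number of $k$-tuples $(g_1,\ldots,g_k)\in G^k$ with $\langle g_1,\ldots,g_k\rangle=G$. $\operatorname{rank}(G)$ is the minimal cardinality of a generating set of $G$ (so the trivial group has rank $0$). $\operatorname{len}(G)$, the chain length of $G$, is the length $n$ of any composition series $\{e\}=G_0\trianglelefteq G_1\trianglelefteq\cdots\trianglelefteq G_n=G$ with every quotient $G_i/G_{i-1}$ simple (this is independent of the series; the trivial group has length $0$). *)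

theory Defs
  imports Complex_Main "HOL-Algebra.Algebra"
begin

primrec lower_central :: "('a, 'b) monoid_scheme \<Rightarrow> nat \<Rightarrow> 'a set" where
  "lower_central G 0 = carrier G"
| "lower_central G (Suc n) = generate G
     {x \<otimes>\<^bsub>G\<^esub> y \<otimes>\<^bsub>G\<^esub> inv\<^bsub>G\<^esub> x \<otimes>\<^bsub>G\<^esub> inv\<^bsub>G\<^esub> y | x y. x \<in> lower_central G n \<and> y \<in> carrier G}"

definition nilpotent_group :: "('a, 'b) monoid_scheme \<Rightarrow> bool" where
  "nilpotent_group G \<longleftrightarrow> Group.group G \<and> (\<exists>n. lower_central G n = {\<one>\<^bsub>G\<^esub>})"

text \<open>A k-tuple of group elements is a list of length k; entries may repeat, so normalising the
  number of generating tuples by the number of all tuples gives the probability for sampling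
  with replacement.\<close>

definition generating_tuples :: "('a, 'b) monoid_scheme \<Rightarrow> nat \<Rightarrow> 'a list set" where
  "generating_tuples G k =
     {gs. length gs = k \<and> set gs \<subseteq> carrier G \<and> generate G (set gs) = carrier G}"

definition generation_prob :: "('a, 'b) monoid_scheme \<Rightarrow> nat \<Rightarrow> real" where
  "generation_prob G k = real (card (generating_tuples G k)) / real (order G) ^ k"

text \<open>The following is meant for finitely generated groups only.\<close>

definition group_rank :: "('a, 'b) monoid_scheme \<Rightarrow> nat" where
  "group_rank G =
     (LEAST n. \<exists>S. S \<subseteq> carrier G \<and> finite S \<and> card S = n \<and> generate G S = carrier G)"

text \<open>Only the values H 0, ..., H n matter below. That each of them is a subgroup of G follows by
  descending induction from H n = carrier G, and \<^term>\<open>simple_group\<close> excludes the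
  trivial group, so the inclusions are strict.\<close>

definition composition_series :: "('a, 'b) monoid_scheme \<Rightarrow> nat \<Rightarrow> (nat \<Rightarrow> 'a set) \<Rightarrow> bool" where
  "composition_series G n H \<longleftrightarrow>
     H 0 = {\<one>\<^bsub>G\<^esub>} \<and> H n = carrier G \<and>
     (\<forall>i<n. H i \<lhd> (G\<lparr>carrier := H (Suc i)\<rparr>) \<and>
            simple_group ((G\<lparr>carrier := H (Suc i)\<rparr>) Mod H i))"

text \<open>For finite groups the description is proper: a composition series exists, and by
  Jordan--Hoelder its length does not depend on the choice of the series.\<close>

definition chain_length :: "('a, 'b) monoid_scheme \<Rightarrow> nat" where
  "chain_length G = (THE n. \<exists>H. composition_series G n H)"

end

theory Submission
  imports Defs
begin

text \<open>The tuples that fail to generate lie in some maximal subgroup, so by the union bound the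
  probability of failure is at most the sum of \<open>[G : M]\<^sup>-\<^sup>k\<close> over the maximal subgroups \<open>M\<close>.
  In a nilpotent group each of them is normal of prime index \<open>p\<close>, and \<open>p - 1\<close> times their number
  is less than the number of homomorphisms into the integers modulo \<open>p\<close>. Such a homomorphism is
  determined by its values on a minimal generating set of \<open>G\<close>, and also by its values on
  generators of a Sylow \<open>p\<close>-subgroup, of which at most \<open>e\<^sub>p\<close> are needed, where \<open>p\<close> has exponent
  \<open>e\<^sub>p\<close> in the order of \<open>G\<close>. With \<open>d\<close> the rank, the first choice bounds the probability of
  failure by the sum of \<open>p\<^sup>d\<^sup>-\<^sup>k / (p - 1)\<close>, which is compared with a telescoping series. The
  second choice bounds it by \<open>2\<^sup>-\<^sup>k\<close> times the sum of the powers of \<open>2\<close> with exponents \<open>e\<^sub>p\<close>.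
  That sum is at most their product, and the chain length is the sum of the \<open>e\<^sub>p\<close>.\<close>

section \<open>Nilpotent groups and maximal subgroups\<close>

text \<open>A prime divisor \<open>p\<close> of the order is the order of some subgroup (Cauchy,
  here \<open>sylow_thm\<close> with exponent 1), and that subgroup can only be the whole
  group.\<close>

lemma (in group) prime_order_if_no_proper_subgroup:
  assumes "finite (carrier G)" "carrier G \<noteq> {\<one>}"
    and "\<And>H. subgroup H G \<Longrightarrow> H = {\<one>} \<or> H = carrier G"
  shows "Factorial_Ring.prime (order G)"
proof -
  have "order G \<noteq> 1" using assms(2) order_one_triv_iff by simp
  then obtain p where p: "Factorial_Ring.prime p" "p dvd order G"
    using prime_factor_nat by blast
  then obtain m where "order G = p ^ 1 * m" by auto
  from sylow_thm[OF p(1) group_axioms this assms(1)]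
  obtain H where H: "subgroup H G" "card H = p" by auto
  have "H \<noteq> {\<one>}" using H(2) p(1) by auto
  then have "H = carrier G" using assms(3) H(1) by blast
  then show ?thesis using H(2) p(1) by (simp add: order_def)
qed

section \<open>The lower central series of subgroups and quotients\<close>

lemma (in group) lower_central_subset: "lower_central G n \<subseteq> carrier G"
proof (induction n)
  case (Suc n)
  then have "{x \<otimes> y \<otimes> inv x \<otimes> inv y | x y. x \<in> lower_central G n \<and> y \<in> carrier G} \<subseteq> carrier G"
    by auto
  then show ?case unfolding lower_central.simps by (rule generate_incl)
qed simp

lemma (in group) one_in_lower_central: "\<one> \<in> lower_central G n"
  by (cases n) (auto intro: generate.one)

text \<open>Commutators of elements of \<open>K\<close> are commutators in \<open>G\<close>;
  inverses and generated subgroups come out the same in \<open>K\<close> as in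
  \<open>G\<close>.\<close>

lemma (in group) lower_central_subgroup_subset:
  assumes "subgroup K G"
  shows "lower_central (G\<lparr>carrier := K\<rparr>) n \<subseteq> lower_central G n"
proof (induction n)
  case 0
  then show ?case using assms by (simp add: subgroup.subset)
next
  case (Suc n)
  let ?K = "G\<lparr>carrier := K\<rparr>"
  let ?C = "{x \<otimes>\<^bsub>?K\<^esub> y \<otimes>\<^bsub>?K\<^esub> inv\<^bsub>?K\<^esub> x \<otimes>\<^bsub>?K\<^esub> inv\<^bsub>?K\<^esub> y | x y.
    x \<in> lower_central ?K n \<and> y \<in> carrier ?K}"
  have K: "lower_central ?K n \<subseteq> K"
    using group.lower_central_subset[OF subgroup_imp_group[OF assms]] by simp
  have KG: "K \<subseteq> carrier G" using assms by (simp add: subgroup.subset)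
  have inv: "inv\<^bsub>?K\<^esub> x = inv x" if "x \<in> K" for x
    using m_inv_consistent[OF assms that] .
  have C: "?C \<subseteq> K"
  proof safe
    fix x y assume "x \<in> lower_central ?K n" "y \<in> carrier ?K"
    then show "x \<otimes>\<^bsub>?K\<^esub> y \<otimes>\<^bsub>?K\<^esub> inv\<^bsub>?K\<^esub> x \<otimes>\<^bsub>?K\<^esub> inv\<^bsub>?K\<^esub> y \<in> K"
      using K inv subgroupE(3,4)[OF assms] by (auto simp: subset_iff)
  qed
  have "?C \<subseteq> {x \<otimes> y \<otimes> inv x \<otimes> inv y | x y. x \<in> lower_central G n \<and> y \<in> carrier G}"
  proof safe
    fix x y assume x: "x \<in> lower_central ?K n" and y: "y \<in> carrier ?K"
    then have "inv\<^bsub>?K\<^esub> x = inv x" "inv\<^bsub>?K\<^esub> y = inv y" using inv K by auto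
    then show "\<exists>x' y'. x \<otimes>\<^bsub>?K\<^esub> y \<otimes>\<^bsub>?K\<^esub> inv\<^bsub>?K\<^esub> x \<otimes>\<^bsub>?K\<^esub> inv\<^bsub>?K\<^esub> y = x' \<otimes> y' \<otimes> inv x' \<otimes> inv y' \<and>
      x' \<in> lower_central G n \<and> y' \<in> carrier G"
      using x y Suc.IH KG by (intro exI[of _ x] exI[of _ y]) auto
  qed
  then have "generate G ?C \<subseteq> lower_central G (Suc n)"
    by (simp only: lower_central.simps mono_generate)
  then show ?case
    unfolding lower_central.simps using generate_consistent[OF C assms] by simp
qed

text \<open>Homomorphisms map commutators to commutators; surjectivity lets the second entry range
  over all of \<open>H\<close>.\<close>

lemma (in group_hom) lower_central_image:
  assumes "h ` carrier G = carrier H"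
  shows "lower_central H n = h ` lower_central G n"
proof (induction n)
  case (Suc n)
  let ?C = "{x \<otimes> y \<otimes> inv x \<otimes> inv y | x y. x \<in> lower_central G n \<and> y \<in> carrier G}"
  have C: "?C \<subseteq> carrier G"
    using G.lower_central_subset[of n] by auto
  have hC: "h (x \<otimes> y \<otimes> inv x \<otimes> inv y) = h x \<otimes>\<^bsub>H\<^esub> h y \<otimes>\<^bsub>H\<^esub> inv\<^bsub>H\<^esub> h x \<otimes>\<^bsub>H\<^esub> inv\<^bsub>H\<^esub> h y"
    if "x \<in> lower_central G n" "y \<in> carrier G" for x y
  proof -
    have "x \<in> carrier G" using that G.lower_central_subset by blast
    with that show ?thesis by simp
  qed
  have "{x \<otimes>\<^bsub>H\<^esub> y \<otimes>\<^bsub>H\<^esub> inv\<^bsub>H\<^esub> x \<otimes>\<^bsub>H\<^esub> inv\<^bsub>H\<^esub> y | x y. x \<in> lower_central H n \<and> y \<in> carrier H} = h ` ?C"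
    (is "?D = _")
  proof
    show "?D \<subseteq> h ` ?C"
      unfolding Suc.IH assms[symmetric] using hC[symmetric] by blast
    show "h ` ?C \<subseteq> ?D"
      unfolding Suc.IH assms[symmetric] using hC by blast
  qed
  then show ?case
    by (simp only: lower_central.simps generate_img[OF C])
qed (simp add: assms)

lemma nilpotent_subgroup:
  fixes G (structure)
  assumes "nilpotent_group G" "subgroup K G"
  shows "nilpotent_group (G\<lparr>carrier := K\<rparr>)"
proof -
  interpret group G using assms(1) by (simp add: nilpotent_group_def)
  interpret K: group "G\<lparr>carrier := K\<rparr>" using subgroup_imp_group[OF assms(2)] .
  obtain n where "lower_central G n = {\<one>\<^bsub>G\<^esub>}" using assms(1) by (auto simp: nilpotent_group_def)
  then have "lower_central (G\<lparr>carrier := K\<rparr>) n = {\<one>\<^bsub>G\<^esub>}"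
    using lower_central_subgroup_subset[OF assms(2), of n] K.one_in_lower_central[of n] by auto
  then show ?thesis using K.group_axioms by (auto simp: nilpotent_group_def)
qed

lemma nilpotent_FactGroup:
  fixes G (structure)
  assumes "nilpotent_group G" "N \<lhd> G"
  shows "nilpotent_group (G Mod N)"
proof -
  interpret normal N G using assms(2) .
  interpret Q: group "G Mod N" by (rule factorgroup_is_group)
  interpret h: group_hom G "G Mod N" "(#>) N"
    by unfold_locales (rule r_coset_hom_Mod)
  obtain n where n: "lower_central G n = {\<one>}" using assms(1) by (auto simp: nilpotent_group_def)
  have "lower_central (G Mod N) n = {\<one>\<^bsub>G Mod N\<^esub>}"
    using h.lower_central_image[of n] h.hom_one by (simp add: n carrier_FactGroup)
  then show ?thesis using Q.group_axioms by (auto simp: nilpotent_group_def)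
qed

lemma (in group) lower_central_1: "lower_central G 1 = derived G (carrier G)"
proof -
  have "{x \<otimes> y \<otimes> inv x \<otimes> inv y | x y. x \<in> carrier G \<and> y \<in> carrier G} = derived_set G (carrier G)"
    by blast
  then show ?thesis by (simp add: derived_def)
qed

lemma (in group) derived_trivial_imp_comm_group:
  assumes "derived G (carrier G) = {\<one>}"
  shows "comm_group G"
proof (rule group_comm_groupI)
  fix x y assume xy: "x \<in> carrier G" "y \<in> carrier G"
  then have "x \<otimes> y \<otimes> inv x \<otimes> inv y \<in> derived G (carrier G)"
    unfolding derived_def by (intro generate.incl) blast
  then have "x \<otimes> y \<otimes> inv x \<otimes> inv y = \<one>" using assms by simp
  then have "(x \<otimes> y) \<otimes> inv (y \<otimes> x) = \<one>" using xy by (simp add: inv_mult_group m_assoc)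
  then show "x \<otimes> y = y \<otimes> x" using xy by (metis inv_closed inv_equality inv_inv m_closed)
qed

text \<open>If the derived subgroup were everything, the lower central series would be constant,
  against nilpotency. Being normal, it is therefore trivial. The group is then abelian, so all its
  subgroups are normal and simplicity leaves only the two trivial ones.\<close>

lemma simple_nilpotent_prime_order:
  fixes G (structure)
  assumes "simple_group G" "nilpotent_group G" "finite (carrier G)"
  shows "Factorial_Ring.prime (order G)"
proof -
  interpret simple_group G by fact
  have "derived G (carrier G) \<noteq> carrier G"
  proof
    assume d: "derived G (carrier G) = carrier G"
    have "lower_central G n = carrier G" for n
    proof (induction n)
      case (Suc n)
      then have "lower_central G (Suc n) = lower_central G (Suc 0)" by simp
      then show ?case using d lower_central_1 by simp
    qed simp
    then show False using assms(2) simple_not_triv by (auto simp: nilpotent_group_def)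
  qed
  then have "derived G (carrier G) = {\<one>}"
    using no_real_normal_subgroup[OF derived_self_is_normal] by blast
  then interpret comm_group G by (rule derived_trivial_imp_comm_group)
  show ?thesis
    using no_real_normal_subgroup subgroup_imp_normal simple_not_triv assms(3)
    by (intro prime_order_if_no_proper_subgroup) auto
qed

section \<open>Maximal subgroups and their quotients\<close>

definition maximal_subgroup :: "'a set \<Rightarrow> ('a, 'b) monoid_scheme \<Rightarrow> bool" where
  "maximal_subgroup M G \<longleftrightarrow> subgroup M G \<and> M \<noteq> carrier G \<and>
     (\<forall>K. subgroup K G \<longrightarrow> M \<subseteq> K \<longrightarrow> K = M \<or> K = carrier G)"

lemma (in group) proper_subgroup_in_maximal:
  assumes "finite (carrier G)" "subgroup H G" "H \<noteq> carrier G"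
  obtains M where "maximal_subgroup M G" "H \<subseteq> M"
proof -
  let ?A = "{K. subgroup K G \<and> K \<noteq> carrier G \<and> H \<subseteq> K}"
  have "finite ?A"
    by (rule finite_subset[of _ "Pow (carrier G)"]) (auto simp: assms(1) dest: subgroup.subset)
  moreover have "H \<in> ?A" using assms by simp
  ultimately have "\<exists>M\<in>?A. H \<subseteq> M \<and> (\<forall>K\<in>?A. M \<subseteq> K \<longrightarrow> M = K)"
    by (rule finite_has_maximal2)
  then obtain M where M: "M \<in> ?A" and max: "\<forall>K\<in>?A. M \<subseteq> K \<longrightarrow> M = K"
    by (elim bexE conjE)
  have "K = M \<or> K = carrier G" if K: "subgroup K G" "M \<subseteq> K" for K
  proof (cases "K = carrier G")
    case False
    with K M have "K \<in> ?A" by blast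
    then have "M = K" using max K(2) by blast
    then show ?thesis by simp
  qed simp
  then have "maximal_subgroup M G" unfolding maximal_subgroup_def using M by blast
  then show thesis using M by (intro that[of M]) blast+
qed

lemma (in group) mult_inv_cancel_left:
  assumes "a \<in> carrier G" "b \<in> carrier G"
  shows "a \<otimes> (inv a \<otimes> b) = b" "inv a \<otimes> (a \<otimes> b) = b"
  using assms by (simp_all add: m_assoc[symmetric])

text \<open>This is the normaliser of \<open>M\<close>. The equivalence expresses
  \<open>g M g^-1 = M\<close> rather than an inclusion, so closure under inverses follows by
  substituting a conjugate for \<open>m\<close>.\<close>

lemma (in group) conj_stabilizer_subgroup:
  assumes "M \<subseteq> carrier G"
  shows "subgroup {g \<in> carrier G. \<forall>m\<in>carrier G. m \<in> M \<longleftrightarrow> g \<otimes> m \<otimes> inv g \<in> M} G" (is "subgroup ?N G")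
proof (rule subgroupI)
  show "?N \<subseteq> carrier G" by blast
  have "\<one> \<in> ?N" by simp
  then show "?N \<noteq> {}" by blast
next
  fix a assume a: "a \<in> ?N"
  have "m \<in> M \<longleftrightarrow> inv a \<otimes> m \<otimes> inv (inv a) \<in> M" if m: "m \<in> carrier G" for m
  proof -
    have "a \<otimes> (inv a \<otimes> m \<otimes> a) \<otimes> inv a = m"
      using a m by (simp add: m_assoc mult_inv_cancel_left)
    moreover have "inv a \<otimes> m \<otimes> a \<in> M \<longleftrightarrow> a \<otimes> (inv a \<otimes> m \<otimes> a) \<otimes> inv a \<in> M"
      using a m by blast
    moreover have "inv (inv a) = a" using a by (intro inv_inv) blast
    ultimately show ?thesis by (simp only:)
  qed
  moreover have "inv a \<in> carrier G" using a by blast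
  ultimately show "inv a \<in> ?N" by blast
next
  fix a b assume ab: "a \<in> ?N" "b \<in> ?N"
  have "m \<in> M \<longleftrightarrow> a \<otimes> b \<otimes> m \<otimes> inv (a \<otimes> b) \<in> M" if m: "m \<in> carrier G" for m
  proof -
    have "a \<otimes> b \<otimes> m \<otimes> inv (a \<otimes> b) = a \<otimes> (b \<otimes> m \<otimes> inv b) \<otimes> inv a"
      using ab m by (simp add: m_assoc inv_mult_group)
    moreover have "m \<in> M \<longleftrightarrow> b \<otimes> m \<otimes> inv b \<in> M" using ab m by blast
    moreover have "b \<otimes> m \<otimes> inv b \<in> M \<longleftrightarrow> a \<otimes> (b \<otimes> m \<otimes> inv b) \<otimes> inv a \<in> M"
      using ab m by blast
    ultimately show ?thesis by (simp only:)
  qed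
  moreover have "a \<otimes> b \<in> carrier G" using ab by blast
  ultimately show "a \<otimes> b \<in> ?N" by blast
qed

text \<open>Let \<open>n\<close> be the first index for which the \<open>(n+1)\<close>-st term of the lower central series lies in
  \<open>M\<close>. The \<open>n\<close>-th term normalizes \<open>M\<close> but is not contained in it.\<close>
lemma maximal_subgroup_normal:
  fixes G (structure)
  assumes "nilpotent_group G" "maximal_subgroup M G"
  shows "M \<lhd> G"
proof -
  interpret group G using assms(1) by (simp add: nilpotent_group_def)
  have M: "subgroup M G" "M \<noteq> carrier G" "M \<subseteq> carrier G"
    using assms(2) by (auto simp: maximal_subgroup_def subgroup.subset)
  obtain N where "lower_central G N = {\<one>}" using assms(1) by (auto simp: nilpotent_group_def)
  then have "lower_central G N \<subseteq> M" using M(1) by (simp add: subgroup.one_closed)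
  \<comment> \<open>If non-containment in \<open>M\<close> always passed to the next term, induction
    would carry it from 0 up to \<open>N\<close>.\<close>
  moreover have "\<not> lower_central G 0 \<subseteq> M" using M by auto
  then have "\<not> lower_central G N \<subseteq> M"
    if "\<And>n. \<not> lower_central G n \<subseteq> M \<Longrightarrow> \<not> lower_central G (Suc n) \<subseteq> M"
    using that by (induction N) blast+
  ultimately obtain n where n: "\<not> lower_central G n \<subseteq> M" "lower_central G (Suc n) \<subseteq> M"
    by blast
  then obtain x where x: "x \<in> lower_central G n" "x \<notin> M" by blast
  have xG: "x \<in> carrier G" using x lower_central_subset by blast
  let ?N = "{g \<in> carrier G. \<forall>m\<in>carrier G. m \<in> M \<longleftrightarrow> g \<otimes> m \<otimes> inv g \<in> M}"
  have "m \<in> M \<longleftrightarrow> x \<otimes> m \<otimes> inv x \<in> M" if m: "m \<in> carrier G" for m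
  proof -
    \<comment> \<open>Conjugation by \<open>x\<close> changes \<open>m\<close> only by a commutator
      from the next term, hence by a factor in \<open>M\<close>.\<close>
    have "x \<otimes> m \<otimes> inv x \<otimes> inv m \<in> lower_central G (Suc n)"
      using x m by (auto intro!: generate.incl)
    then have c: "x \<otimes> m \<otimes> inv x \<otimes> inv m \<in> M" using n by blast
    have "x \<otimes> m \<otimes> inv x = (x \<otimes> m \<otimes> inv x \<otimes> inv m) \<otimes> m"
      "inv (x \<otimes> m \<otimes> inv x \<otimes> inv m) \<otimes> (x \<otimes> m \<otimes> inv x) = m"
      using xG m by (simp_all add: m_assoc inv_mult_group mult_inv_cancel_left)
    then show ?thesis
      using subgroupE(4)[OF M(1) c, of m]
        subgroupE(4)[OF M(1) subgroupE(3)[OF M(1) c], of "x \<otimes> m \<otimes> inv x"] by auto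
  qed
  then have "x \<in> ?N" using xG by blast
  moreover have "M \<subseteq> ?N"
  proof
    fix g assume g: "g \<in> M"
    then have gG: "g \<in> carrier G" using M by blast
    have "m \<in> M \<longleftrightarrow> g \<otimes> m \<otimes> inv g \<in> M" if m: "m \<in> carrier G" for m
    proof -
      have "inv g \<otimes> (g \<otimes> m \<otimes> inv g) \<otimes> g = m"
        using m gG by (simp add: m_assoc mult_inv_cancel_left)
      moreover have "inv g \<in> M" using subgroupE(3)[OF M(1) g] .
      ultimately show ?thesis
        using g subgroupE(4)[OF M(1)] by (metis (no_types))
    qed
    with gG show "g \<in> ?N" by blast
  qed
  \<comment> \<open>The normaliser contains \<open>M\<close> and also \<open>x\<close>, which is
    outside \<open>M\<close>; maximality makes it the whole group.\<close>
  ultimately have "?N = carrier G"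
    using assms(2) conj_stabilizer_subgroup[OF M(3)] x(2) unfolding maximal_subgroup_def by blast
  then show ?thesis
    using M by (intro normal_invI) blast+
qed

text \<open>Subgroups of the quotient correspond to subgroups between \<open>M\<close> and
  \<open>G\<close>, and maximality leaves only the two ends. The union of a set of cosets serves as
  its preimage in \<open>G\<close>.\<close>

lemma maximal_subgroup_prime_index:
  fixes G (structure)
  assumes "nilpotent_group G" "finite (carrier G)" "maximal_subgroup M G"
  shows "Factorial_Ring.prime (order (G Mod M))"
proof -
  interpret normal M G by (rule maximal_subgroup_normal[OF assms(1,3)])
  interpret Q: group "G Mod M" by (rule factorgroup_is_group)
  show ?thesis
  proof (rule Q.prime_order_if_no_proper_subgroup)
    show "finite (carrier (G Mod M))" using assms(2) by (simp add: carrier_FactGroup)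
    show "carrier (G Mod M) \<noteq> {\<one>\<^bsub>G Mod M\<^esub>}"
      using assms(2,3) fact_group_trivial_iff by (simp add: maximal_subgroup_def)
  next
    fix A assume A: "subgroup A (G Mod M)"
    have U: "\<Union> A = {x \<in> carrier G. M #> x \<in> A}" by (rule factgroup_subgroup_union_char[OF A])
    have "M \<in> A" using subgroup.one_closed[OF A] by simp
    then have "M \<subseteq> \<Union> A" by blast
    then consider "\<Union> A = M" | "\<Union> A = carrier G"
      using assms(3) factgroup_subgroup_union_subgroup[OF A] unfolding maximal_subgroup_def by blast
    then show "A = {\<one>\<^bsub>G Mod M\<^esub>} \<or> A = carrier (G Mod M)"
    proof cases
      case 1
      have "a = M" if "a \<in> A" for a
      proof -
        obtain x where x: "x \<in> carrier G" "a = M #> x"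
          using subgroup.subset[OF A] \<open>a \<in> A\<close> by (auto simp: carrier_FactGroup)
        then have "x \<in> M" using U 1 that by blast
        then show ?thesis using x rcos_const by blast
      qed
      then have "A = {M}" using \<open>M \<in> A\<close> by blast
      then show ?thesis by simp
    next
      case 2
      then have "carrier (G Mod M) \<subseteq> A" unfolding carrier_FactGroup using U by blast
      with subgroup.subset[OF A] have "A = carrier (G Mod M)" by (rule equalityI)
      then show ?thesis ..
    qed
  qed
qed

section \<open>Composition series\<close>

text \<open>By induction on the order, a series of a maximal subgroup \<open>M\<close> is prolonged
  by \<open>G\<close>; the new factor has prime order and so is simple.\<close>

lemma nilpotent_composition_series_exists:
  fixes G (structure)
  assumes "nilpotent_group G" "finite (carrier G)"
  shows "\<exists>n H. composition_series G n H"
  using assms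
proof (induction "order G" arbitrary: G rule: less_induct)
  case (less G)
  interpret group G using less.prems(1) by (simp add: nilpotent_group_def)
  show ?case
  proof (cases "carrier G = {\<one>\<^bsub>G\<^esub>}")
    case True
    then have "composition_series G 0 (\<lambda>_. {\<one>\<^bsub>G\<^esub>})" by (simp add: composition_series_def)
    then show ?thesis by blast
  next
    case False
    then obtain M where M: "maximal_subgroup M G"
      using proper_subgroup_in_maximal[OF less.prems(2) triv_subgroup] by metis
    then have sub: "subgroup M G" "M \<noteq> carrier G" by (auto simp: maximal_subgroup_def)
    have fin: "finite M" using less.prems(2) sub(1) by (meson finite_subset subgroup.subset)
    have normal: "M \<lhd> G" using maximal_subgroup_normal[OF less.prems(1) M] .
    interpret Q: group "G Mod M" using normal by (rule normal.factorgroup_is_group)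
    have simple: "simple_group (G Mod M)"
      by (rule Q.prime_order_simple[OF maximal_subgroup_prime_index[OF less.prems M]])
    have "M \<subset> carrier G" using sub by (auto dest: subgroup.subset)
    then have "order (G\<lparr>carrier := M\<rparr>) < order G"
      using less.prems(2) by (simp add: order_def psubset_card_mono)
    then obtain n H where H: "composition_series (G\<lparr>carrier := M\<rparr>) n H"
      using less.hyps nilpotent_subgroup[OF less.prems(1) sub(1)] fin by fastforce
    let ?H = "\<lambda>i. if i \<le> n then H i else carrier G"
    have "composition_series G (Suc n) ?H"
      unfolding composition_series_def
    proof (intro conjI allI impI)
      fix i assume "i < Suc n"
      then consider "i < n" | "i = n" by linarith
      then show "?H i \<lhd> G\<lparr>carrier := ?H (Suc i)\<rparr>"
        by cases (use H normal in \<open>auto simp: composition_series_def\<close>)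
      from \<open>i < Suc n\<close> consider "i < n" | "i = n" by linarith
      then show "simple_group (G\<lparr>carrier := ?H (Suc i)\<rparr> Mod ?H i)"
        by cases (use H simple in \<open>auto simp: composition_series_def\<close>)
    qed (use H in \<open>auto simp: composition_series_def\<close>)
    then show ?thesis by blast
  qed
qed

text \<open>Every factor is simple and nilpotent, hence of prime order, so each step adds one prime
  factor to the order. This settles uniqueness of the length without Jordan--Hoelder.\<close>

lemma nilpotent_composition_series_length:
  fixes G (structure)
  assumes "nilpotent_group G" "finite (carrier G)" "composition_series G n H"
  shows "n = size (prime_factorization (order G))"
proof -
  interpret group G using assms(1) by (simp add: nilpotent_group_def)
  have H0: "H 0 = {\<one>}" and Hn: "H n = carrier G"
    and nor: "\<And>i. i < n \<Longrightarrow> H i \<lhd> G\<lparr>carrier := H (Suc i)\<rparr>"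
    and sim: "\<And>i. i < n \<Longrightarrow> simple_group (G\<lparr>carrier := H (Suc i)\<rparr> Mod H i)"
    using assms(3) by (auto simp: composition_series_def)
  \<comment> \<open>Descending induction: \<open>H n\<close> is the whole group, and each
    \<open>H i\<close> is a subgroup of the next one.\<close>
  have sub: "subgroup (H i) G" if "i \<le> n" for i
    using that
  proof (induction rule: inc_induct)
    case base
    show ?case using subgroup_self Hn by simp
  next
    case (step i)
    then show ?case using incl_subgroup nor normal_imp_subgroup by blast
  qed
  have fin: "finite (H i)" if "i \<le> n" for i
    using sub[OF that] assms(2) by (meson finite_subset subgroup.subset)
  have "size (prime_factorization (card (H i))) = i" if "i \<le> n" for i
    using that
  proof (induction i)
    case 0
    show ?case by (simp add: H0)
  next
    case (Suc i)
    let ?K = "G\<lparr>carrier := H (Suc i)\<rparr>"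
    let ?Q = "?K Mod H i"
    have i: "i < n" using Suc.prems by simp
    interpret K: group ?K using subgroup_imp_group[OF sub[OF Suc.prems]] .
    have "finite (carrier ?Q)" using fin[OF Suc.prems] by (simp add: carrier_FactGroup)
    then have prime: "Factorial_Ring.prime (order ?Q)"
      using sim[OF i] nilpotent_FactGroup[OF nilpotent_subgroup[OF assms(1) sub[OF Suc.prems]] nor[OF i]]
      by (intro simple_nilpotent_prime_order)
    have "order ?Q * card (H i) = card (H (Suc i))"
      using K.lagrange[OF normal_imp_subgroup[OF nor[OF i]]] by (simp add: order_def FactGroup_def)
    moreover have "card (H i) \<noteq> 0"
      using fin[of i] sub[of i] i by (auto dest: subgroup.one_closed)
    ultimately show ?case
      using prime Suc.IH i
      by (simp flip: \<open>order ?Q * card (H i) = _\<close>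
          add: prime_factorization_mult prime_factorization_prime prime_gt_0_nat)
  qed
  from this[of n] show ?thesis by (simp add: Hn order_def)
qed

lemma nilpotent_chain_length:
  assumes "nilpotent_group G" "finite (carrier G)"
  shows "chain_length G = size (prime_factorization (order G))"
  unfolding chain_length_def
  using nilpotent_composition_series_exists[OF assms] nilpotent_composition_series_length[OF assms]
  by (intro the_equality) blast+

section \<open>Counting subgroups of prime index\<close>

text \<open>A nontrivial element of a group of prime order has full order. The isomorphism sends 1
  to \<open>c\<close>, so \<open>c\<close> can be recovered from it.\<close>

lemma (in group) prime_order_int_pow_iso:
  assumes "Factorial_Ring.prime (order G)" "c \<in> carrier G" "c \<noteq> \<one>"
  shows "(\<lambda>i::int. c [^] i) \<in> iso (integer_mod_group (order G)) G"
proof (rule isoI)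
  let ?p = "order G"
  have p: "?p > 0" using assms(1) by (simp add: prime_gt_0_nat)
  then have fin: "finite (carrier G)" by (simp add: order_gt_0_iff_finite)
  have "ord c \<noteq> 1" using ord_eq_1[OF assms(2)] assms(3) by blast
  then have ord: "ord c = ?p"
    using ord_dvd_group_order[OF assms(2)] assms(1) prime_nat_iff by blast
  have carrier: "carrier (integer_mod_group ?p) = {0..<int ?p}"
    using p by (simp add: carrier_integer_mod_group)
  have "c [^] ((x + y) mod int ?p) = c [^] x \<otimes> c [^] y" for x y :: int
    using assms(2) by (simp add: int_pow_mult int_pow_eq ord mod_eq_dvd_iff flip: int_pow_mult)
  then show "(\<lambda>i::int. c [^] i) \<in> hom (integer_mod_group ?p) G"
    using assms(2) by (intro homI) auto
  have inj: "inj_on (\<lambda>i::int. c [^] i) {0..<int ?p}"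
  proof (rule inj_onI)
    fix x y assume xy: "x \<in> {0..<int ?p}" "y \<in> {0..<int ?p}" "c [^] x = c [^] y"
    then have "int ?p dvd y - x" using assms(2) by (simp add: int_pow_eq ord)
    then have "y mod int ?p = x mod int ?p" by (simp only: mod_eq_dvd_iff)
    then show "x = y" using xy by simp
  qed
  have "(\<lambda>i::int. c [^] i) ` {0..<int ?p} = carrier G"
    using assms(2) inj fin by (intro card_subset_eq) (auto simp: card_image order_def)
  with inj show "bij_betw (\<lambda>i::int. c [^] i) (carrier (integer_mod_group ?p)) (carrier G)"
    by (simp add: bij_betw_def carrier)
qed

text \<open>The quotient map is followed by the inverse of the isomorphism sending 1 to
  \<open>c\<close>. The fibres over 0 and 1 let the pair \<open>(H, c)\<close> be read off from
  \<open>f\<close>, which is what makes the later counting injective.\<close>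

lemma (in normal) prime_index_hom:
  assumes "Factorial_Ring.prime (order (G Mod H))" "c \<in> carrier (G Mod H)" "c \<noteq> H"
  obtains f where "f \<in> hom G (integer_mod_group (order (G Mod H)))"
    "{x \<in> carrier G. f x = 0} = H" "{x \<in> carrier G. f x = 1} = c"
proof -
  let ?Q = "G Mod H" and ?p = "order (G Mod H)"
  interpret Q: group ?Q by (rule factorgroup_is_group)
  let ?g = "\<lambda>i::int. c [^]\<^bsub>?Q\<^esub> i"
  have iso: "?g \<in> iso (integer_mod_group ?p) ?Q"
    using assms by (intro Q.prime_order_int_pow_iso) simp_all
  define g where "g = inv_into (carrier (integer_mod_group ?p)) ?g"
  have "g \<in> hom ?Q (integer_mod_group ?p)"
    unfolding g_def using group.iso_set_sym[OF group_integer_mod_group iso] by (simp add: iso_def)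
  then have hom: "g \<circ> (#>) H \<in> hom G (integer_mod_group ?p)"
    by (rule Group.hom_compose[OF r_coset_hom_Mod])
  have p: "1 < ?p" using assms(1) by (rule prime_gt_1_nat)
  have bij: "bij_betw ?g {0..<int ?p} (carrier ?Q)"
    using iso p by (simp add: iso_def carrier_integer_mod_group)
  have g: "g y = i \<longleftrightarrow> y = ?g i" if "y \<in> carrier ?Q" "i \<in> {0..<int ?p}" for y i
    using bij that p unfolding g_def carrier_integer_mod_group
    by (auto simp: bij_betw_def f_inv_into_f)
  have Q: "H #> x \<in> carrier ?Q" if "x \<in> carrier G" for x
    using that by (simp add: carrier_FactGroup)
  have "{x \<in> carrier G. (g \<circ> (#>) H) x = 0} = {x \<in> carrier G. H #> x = H}"
    using g[OF Q, of _ 0] p by auto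
  also have "\<dots> = H"
    using coset_join1[OF _ _ is_subgroup] coset_join2[OF _ is_subgroup] subset by auto
  finally have 0: "{x \<in> carrier G. (g \<circ> (#>) H) x = 0} = H" .
  have "{x \<in> carrier G. (g \<circ> (#>) H) x = 1} = {x \<in> carrier G. H #> x = c}"
    using g[OF Q, of _ 1] p assms(2) by auto
  also have "\<dots> = c"
  proof -
    obtain y where y: "y \<in> carrier G" "c = H #> y" using assms(2) by (auto simp: carrier_FactGroup)
    show ?thesis
    proof (intro equalityI subsetI)
      fix x assume "x \<in> {x \<in> carrier G. H #> x = c}"
      then show "x \<in> c" using rcos_self[OF _ is_subgroup] by blast
    next
      fix x assume "x \<in> c"
      then show "x \<in> {x \<in> carrier G. H #> x = c}"
        using y repr_independence[OF _ y(1) is_subgroup] r_coset_subset_G[OF subset y(1)] by auto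
    qed
  qed
  finally show thesis using that[OF hom 0] by blast
qed

text \<open>The first isomorphism theorem identifies the index of the kernel with the order of the
  image, which divides the order of the target.\<close>

lemma (in group_hom) index_kernel_dvd:
  assumes "finite (carrier H)"
  shows "card (rcosets\<^bsub>G\<^esub> (kernel G H h)) dvd order H"
proof -
  let ?I = "H\<lparr>carrier := h ` carrier G\<rparr>"
  have sub: "subgroup (h ` carrier G) H" by (rule img_is_subgroup)
  interpret I: group ?I by (rule H.subgroup_imp_group[OF sub])
  interpret hI: group_hom G ?I h
    by (simp add: group_hom_def group_hom_axioms_def) (auto simp: hom_def)
  have "h ` carrier G = carrier ?I" by simp
  from iso_same_order[OF hI.FactGroup_iso_set[OF this]]
  have "card (rcosets\<^bsub>G\<^esub> (kernel G H h)) = card (h ` carrier G)"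
    by (simp add: order_def FactGroup_def kernel_def)
  then show ?thesis using H.lagrange[OF sub] by (metis dvd_triv_right)
qed

text \<open>The kernel of the difference \<open>d\<close> contains the subgroup generated by
  \<open>S\<close>, so its index divides a number prime to \<open>p\<close>; it also divides
  \<open>p\<close>, hence is 1. The index condition covers both generators of \<open>G\<close> and
  generators of a Sylow subgroup.\<close>

lemma (in group) hom_prime_eq_if_index_coprime:
  assumes "finite (carrier G)" "Factorial_Ring.prime p"
    and f: "f \<in> hom G (integer_mod_group p)" and g: "g \<in> hom G (integer_mod_group p)"
    and S: "S \<subseteq> carrier G" "\<not> p dvd order G div card (generate G S)"
    and eq: "\<And>s. s \<in> S \<Longrightarrow> f s = g s"
    and x: "x \<in> carrier G"
  shows "f x = g x"
proof -
  let ?Z = "integer_mod_group p"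
  have p: "p > 0" using assms(2) by (rule prime_gt_0_nat)
  have cZ: "carrier ?Z = {0..<int p}" using p by (simp add: carrier_integer_mod_group)
  \<comment> \<open>Values are integers from 0 to \<open>p - 1\<close>, so their difference must be
    reduced modulo \<open>p\<close>.\<close>
  define d where "d x = (f x - g x) mod int p" for x
  have "d \<in> hom G ?Z"
  proof (rule homI)
    show "d y \<in> carrier ?Z" for y using p by (simp add: d_def cZ)
    show "d (y \<otimes> z) = d y \<otimes>\<^bsub>?Z\<^esub> d z" if "y \<in> carrier G" "z \<in> carrier G" for y z
    proof -
      have "d (y \<otimes> z) = ((f y + f z) mod int p - (g y + g z) mod int p) mod int p"
        using hom_mult[OF f that] hom_mult[OF g that] by (simp add: d_def)
      also have "\<dots> = ((f y - g y) + (f z - g z)) mod int p"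
        by (simp add: mod_diff_eq algebra_simps)
      finally show ?thesis by (simp add: d_def mod_add_eq)
    qed
  qed
  then interpret d: group_hom G ?Z d
    by (simp add: group_hom_def group_hom_axioms_def)
  let ?K = "kernel G ?Z d"
  have K: "subgroup ?K G" by (rule d.subgroup_kernel)
  have "S \<subseteq> ?K" using S(1) eq by (auto simp: kernel_def d_def)
  then have PK: "generate G S \<subseteq> ?K" using K by (rule generate_subgroup_incl)
  have P: "subgroup (generate G S) G" using S(1) by (rule generate_is_subgroup)
  have "subgroup (generate G S) (G\<lparr>carrier := ?K\<rparr>)" by (rule subgroup_incl[OF P K PK])
  then obtain l where l: "l * card (generate G S) = card ?K"
    using group.lagrange[OF subgroup_imp_group[OF K]] by (fastforce simp: order_def)
  have "card (generate G S) \<noteq> 0"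
    using assms(1) P by (metis card_0_eq empty_iff finite_subset subgroup.one_closed subgroup.subset)
  moreover have index: "card (rcosets ?K) * card ?K = order G" by (rule lagrange[OF K])
  \<comment> \<open>Multiplicativity of the index, with \<open>l\<close> the index of the generated
    subgroup in the kernel.\<close>
  ultimately have "order G div card (generate G S) = card (rcosets ?K) * l"
    by (metis l mult.assoc nonzero_mult_div_cancel_right)
  then have "card (rcosets ?K) \<noteq> p" using S(2) by auto
  moreover have "card (rcosets ?K) dvd p"
    using d.index_kernel_dvd by (simp add: cZ order_def)
  ultimately have "card (rcosets ?K) = 1" using assms(2) prime_nat_iff by blast
  then have "card ?K = card (carrier G)" using index by (simp add: order_def)
  then have "?K = carrier G"
    using assms(1) K by (intro card_subset_eq) (auto dest: subgroup.subset)
  then have "(f x - g x) mod int p = 0" using x by (auto simp: kernel_def d_def)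
  then have "f x mod int p = g x mod int p" by (simp add: mod_eq_dvd_iff dvd_eq_mod_eq_0)
  moreover have "f x \<in> {0..<int p}" "g x \<in> {0..<int p}"
    using hom_in_carrier[OF f x] hom_in_carrier[OF g x] cZ by auto
  ultimately show ?thesis by simp
qed

text \<open>Each normal subgroup \<open>M\<close> of index \<open>p\<close> yields \<open>p - 1\<close> homomorphisms onto the integers modulo
  \<open>p\<close>: one for every choice of the coset mapped to \<open>1\<close>. They are determined by their values
  on \<open>S\<close>.\<close>
lemma (in group) card_normal_prime_index:
  assumes fin: "finite (carrier G)" and p: "Factorial_Ring.prime p"
    and S: "S \<subseteq> carrier G" "\<not> p dvd order G div card (generate G S)"
  shows "(p - 1) * card {M. M \<lhd> G \<and> order (G Mod M) = p} < p ^ card S"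
proof -
  let ?A = "{M. M \<lhd> G \<and> order (G Mod M) = p}"
  let ?P = "SIGMA M:?A. carrier (G Mod M) - {M}"
  let ?Z = "integer_mod_group p"
  \<comment> \<open>The zero function is removed because no surjection restricts to it; this yields
    the strict inequality.\<close>
  let ?F = "(S \<rightarrow>\<^sub>E {0..<int p}) - {\<lambda>s\<in>S. 0}"
  have p0: "p > 0" using p by (rule prime_gt_0_nat)
  have cZ: "carrier ?Z = {0..<int p}" using p0 by (simp add: carrier_integer_mod_group)
  have finS: "finite S" using S(1) fin by (rule finite_subset)
  have "\<forall>z\<in>?P. \<exists>f. f \<in> hom G ?Z \<and> {x \<in> carrier G. f x = 0} = fst z \<and> {x \<in> carrier G. f x = 1} = snd z"
  proof
    fix z assume "z \<in> ?P"
    then obtain M c where z: "z = (M, c)" and M: "M \<lhd> G" and order: "order (G Mod M) = p"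
      and c: "c \<in> carrier (G Mod M)" "c \<noteq> M" by blast
    have "Factorial_Ring.prime (order (G Mod M))" using p order by simp
    from normal.prime_index_hom[OF M this c] obtain f where "f \<in> hom G (integer_mod_group (order (G Mod M)))"
      "{x \<in> carrier G. f x = 0} = M" "{x \<in> carrier G. f x = 1} = c" .
    then show "\<exists>f. f \<in> hom G ?Z \<and> {x \<in> carrier G. f x = 0} = fst z \<and> {x \<in> carrier G. f x = 1} = snd z"
      unfolding z order fst_conv snd_conv by blast
  qed
  from bchoice[OF this] obtain f where F: "\<forall>z\<in>?P. f z \<in> hom G ?Z \<and>
    {x \<in> carrier G. f z x = 0} = fst z \<and> {x \<in> carrier G. f z x = 1} = snd z" ..
  have f: "f z \<in> hom G ?Z" "{x \<in> carrier G. f z x = 0} = fst z" "{x \<in> carrier G. f z x = 1} = snd z"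
    if "z \<in> ?P" for z
    using bspec[OF F that] by blast+
  have finQ: "finite (carrier (G Mod M))" for M using fin by (simp add: carrier_FactGroup)
  have finA: "finite ?A"
    by (rule finite_subset[of _ "Pow (carrier G)"])
      (auto simp: fin dest: normal_imp_subgroup subgroup.subset)
  have "card ?P = (\<Sum>M\<in>?A. card (carrier (G Mod M) - {M}))"
    by (rule card_SigmaI) (auto simp: finA finQ)
  also have "\<dots> = (\<Sum>M\<in>?A. p - 1)"
  proof (rule sum.cong)
    fix M assume M: "M \<in> ?A"
    then interpret normal M G by simp
    have "M \<in> carrier (G Mod M)"
      using group.is_monoid[OF factorgroup_is_group] monoid.one_closed by fastforce
    then show "card (carrier (G Mod M) - {M}) = p - 1"
      using M finQ by (simp add: order_def)
  qed simp
  finally have cardP: "card ?P = (p - 1) * card ?A" by simp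
  \<comment> \<open>The restriction to \<open>S\<close> determines the homomorphism, whose fibres
    over 0 and 1 are the two components of the pair.\<close>
  have "inj_on (\<lambda>z. restrict (f z) S) ?P"
  proof (rule inj_onI)
    fix z w assume zw: "z \<in> ?P" "w \<in> ?P" "restrict (f z) S = restrict (f w) S"
    have "f z x = f w x" if "x \<in> carrier G" for x
    proof (rule hom_prime_eq_if_index_coprime[OF fin p f(1)[OF zw(1)] f(1)[OF zw(2)] S _ that])
      show "f z s = f w s" if "s \<in> S" for s using zw(3) that by (metis restrict_apply')
    qed
    then have "{x \<in> carrier G. f z x = i} = {x \<in> carrier G. f w x = i}" for i
      by (intro Collect_cong) auto
    then have "fst z = fst w" "snd z = snd w"
      using f(2,3)[OF zw(1)] f(2,3)[OF zw(2)] by metis+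
    then show "z = w" by (rule prod_eqI)
  qed
  moreover have "(\<lambda>z. restrict (f z) S) ` ?P \<subseteq> ?F"
  proof (rule image_subsetI)
    fix z assume z: "z \<in> ?P"
    have "restrict (f z) S \<in> S \<rightarrow>\<^sub>E {0..<int p}"
      using hom_in_carrier[OF f(1)[OF z]] S(1) cZ by (auto simp: restrict_PiE_iff)
    moreover have "restrict (f z) S \<noteq> (\<lambda>s\<in>S. 0)"
    proof
      assume 0: "restrict (f z) S = (\<lambda>s\<in>S. 0)"
      have triv: "(\<lambda>_. 0) \<in> hom G ?Z" using p0 by (intro homI) (auto simp: cZ)
      have "f z x = 0" if "x \<in> carrier G" for x
      proof (rule hom_prime_eq_if_index_coprime[OF fin p f(1)[OF z] triv S _ that])
        show "f z s = 0" if "s \<in> S" for s using 0 that by (metis restrict_apply')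
      qed
      \<comment> \<open>The fibre over 1 is the chosen coset, which cannot be empty.\<close>
      then have "{x \<in> carrier G. f z x = 1} = {}" by auto
      then have "snd z = {}" using f(3)[OF z] by simp
      moreover obtain M c where c: "z = (M, c)" "M \<lhd> G" "c \<in> carrier (G Mod M)" using z by auto
      moreover obtain x where "x \<in> carrier G" "c = M #> x"
        using c(3) by (auto simp: carrier_FactGroup)
      ultimately show False using rcos_self[of x M] normal_imp_subgroup[of M G] by simp
    qed
    ultimately show "restrict (f z) S \<in> ?F" by blast
  qed
  moreover have "finite ?F" using finS by (simp add: finite_PiE)
  ultimately have "card ?P \<le> card ?F" by (rule card_inj_on_le)
  also have "\<dots> = p ^ card S - 1"
    using p0 finS by (subst card_Diff_singleton) (auto simp: card_PiE restrict_PiE_iff)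
  also have "\<dots> < p ^ card S" using p0 by simp
  finally show ?thesis using cardP by simp
qed

text \<open>Adjoining an element outside the subgroup generated so far multiplies its order by at
  least \<open>p\<close>, since all subgroup orders are powers of \<open>p\<close>. After
  \<open>a\<close> steps the group is exhausted.\<close>

lemma (in group) prime_power_order_generators:
  assumes p: "Factorial_Ring.prime p" and order: "order G = p ^ a"
  obtains S where "S \<subseteq> carrier G" "card S \<le> a" "generate G S = carrier G"
proof -
  have fin: "finite (carrier G)"
    using p order order_gt_0_iff_finite by (simp add: prime_gt_0_nat)
  have pow: "\<exists>b. card H = p ^ b" if "subgroup H G" for H
    using lagrange[OF that] order divides_primepow_nat[OF p] by (metis dvd_triv_right)
  \<comment> \<open>The first alternative of the invariant covers sets that already generate
    everything before \<open>j\<close> elements are used.\<close>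
  have "\<exists>S. S \<subseteq> carrier G \<and> card S \<le> j \<and> (generate G S = carrier G \<or> p ^ j dvd card (generate G S))" for j
  proof (induction j)
    case 0
    show ?case by (intro exI[of _ "{}"]) simp
  next
    case (Suc j)
    then obtain S where S: "S \<subseteq> carrier G" "card S \<le> j"
      "generate G S = carrier G \<or> p ^ j dvd card (generate G S)" by blast
    show ?case
    proof (cases "generate G S = carrier G")
      case True
      then show ?thesis using S by (intro exI[of _ S]) simp
    next
      case False
      have sub: "subgroup (generate G S) G" using S(1) by (rule generate_is_subgroup)
      then obtain x where x: "x \<in> carrier G" "x \<notin> generate G S"
        using False by (auto dest: subgroup.subset)
      have S': "insert x S \<subseteq> carrier G" using S(1) x by simp
      have sub': "subgroup (generate G (insert x S)) G" using S' by (rule generate_is_subgroup)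
      have "generate G S \<subset> generate G (insert x S)"
        using mono_generate[of S "insert x S"] x(2) generate.incl[of x "insert x S" G] by blast
      moreover have "finite (generate G (insert x S))"
        using fin sub' by (meson finite_subset subgroup.subset)
      ultimately have less: "card (generate G S) < card (generate G (insert x S))"
        by (rule psubset_card_mono[rotated])
      obtain b c where bc: "card (generate G S) = p ^ b" "card (generate G (insert x S)) = p ^ c"
        using pow[OF sub] pow[OF sub'] by blast
      have p1: "p > 1" using p by (rule prime_gt_1_nat)
      have "j \<le> b" using False S(3) bc p1 by (simp add: dvd_power_iff_le)
      moreover have "b < c" using less bc p1 by simp
      ultimately have "p ^ Suc j dvd card (generate G (insert x S))"
        using bc by (simp only: le_imp_power_dvd Suc_le_eq)
      moreover have "card (insert x S) \<le> Suc j"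
        using S(2) card_insert_le_m1[of "Suc j" S x] by simp
      ultimately show ?thesis using S' by blast
    qed
  qed
  then obtain S where S: "S \<subseteq> carrier G" "card S \<le> a"
    "generate G S = carrier G \<or> p ^ a dvd card (generate G S)" by blast
  have "generate G S = carrier G"
  proof (rule ccontr)
    assume ne: "generate G S \<noteq> carrier G"
    have sub: "subgroup (generate G S) G" using S(1) by (rule generate_is_subgroup)
    then have "finite (generate G S)" "generate G S \<noteq> {}"
      using fin by (auto intro: finite_subset[OF subgroup.subset] dest: subgroup.one_closed)
    then have "card (generate G S) > 0" by (simp add: card_gt_0_iff)
    then have "card (carrier G) \<le> card (generate G S)"
      using S(3) ne order by (auto simp: order_def dest: dvd_imp_le)
    then have "generate G S = carrier G"
      by (intro card_seteq fin subgroup.subset[OF sub])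
    with ne show False ..
  qed
  with S that show thesis by blast
qed

text \<open>The set generates a Sylow \<open>p\<close>-subgroup, whose index is prime to
  \<open>p\<close>.\<close>

lemma (in group) sylow_generators:
  assumes fin: "finite (carrier G)" and p: "Factorial_Ring.prime p"
  obtains S where "S \<subseteq> carrier G" "card S \<le> multiplicity p (order G)"
    "\<not> p dvd order G div card (generate G S)"
proof -
  have "order G \<noteq> 0" using fin order_gt_0_iff_finite by simp
  then obtain m where m: "order G = p ^ multiplicity p (order G) * m" "\<not> p dvd m"
    using p by (metis multiplicity_decompose' not_prime_unit)
  then obtain P where P: "subgroup P G" "card P = p ^ multiplicity p (order G)"
    using sylow_thm[OF p group_axioms _ fin] by blast
  interpret P: group "G\<lparr>carrier := P\<rparr>" by (rule subgroup_imp_group[OF P(1)])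
  obtain S where S: "S \<subseteq> P" "card S \<le> multiplicity p (order G)" "generate (G\<lparr>carrier := P\<rparr>) S = P"
    using P.prime_power_order_generators[OF p, of "multiplicity p (order G)"] P(2)
    by (auto simp: order_def)
  have gen: "generate G S = P" using S generate_consistent[OF S(1) P(1)] by simp
  have "order G div card P = m"
    using m(1) P(2) p by (metis nonzero_mult_div_cancel_left not_prime_0 power_not_zero)
  then show thesis
    using that[of S] S(1,2) gen m(2) subgroup.subset[OF P(1)] by auto
qed

section \<open>Estimates for sums\<close>

lemma sum_telescope_bound: "(\<Sum>n=2..N. 1 / (real n * (real n - 1))) \<le> 1"
proof -
  \<comment> \<open>Strengthened for induction; \<open>max N 1\<close> makes the bound 0 when
    \<open>N = 0\<close>.\<close>
  have "(\<Sum>n=2..N. 1 / (real n * (real n - 1))) \<le> 1 - 1 / real (max N 1)"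
  proof (induction N)
    case (Suc N)
    show ?case
    proof (cases "N \<ge> 1")
      case True
      then have "1 / (real (Suc N) * (real (Suc N) - 1)) = 1 / real N - 1 / real (Suc N)"
        by (simp add: field_simps)
      with Suc True show ?thesis by (simp add: max_def)
    qed simp
  qed simp
  also have "\<dots> \<le> 1" by simp
  finally show ?thesis .
qed

text \<open>Replacing \<open>t - 1\<close> of the factors \<open>p\<close> by 2 leaves
  \<open>1 / (p (p - 1))\<close>. The sum of these may be enlarged to all integers from 2 on, where
  it telescopes.\<close>

lemma sum_primes_bound:
  assumes "finite A" "\<And>p. p \<in> A \<Longrightarrow> 2 \<le> p" "2 \<le> t"
  shows "(\<Sum>p\<in>A. 1 / ((real p - 1) * real p ^ t)) \<le> 2 / 2 ^ t"
proof -
  have le: "1 / ((real p - 1) * real p ^ t) \<le> 2 / 2 ^ t * (1 / (real p * (real p - 1)))"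
    if p: "2 \<le> p" for p
  proof -
    obtain s where s: "t = Suc (Suc s)" 
      by (rule that[of "t - 2"]) (use assms(3) in simp)
    have "(2::real) ^ s \<le> real p ^ s" using p by (intro power_mono) auto
    moreover have "2 \<le> real p" using p by simp
    ultimately have "2 * 2 ^ s \<le> real p * real p ^ s" by (intro mult_mono) auto
    then have "2 ^ t \<le> 2 * real p ^ Suc s" by (simp add: s)
    then have "(real p * (real p - 1)) * 2 ^ t \<le> (real p * (real p - 1)) * (2 * real p ^ Suc s)"
      using p by (intro mult_left_mono) auto
    then show ?thesis using p by (simp add: s divide_simps)
  qed
  obtain N where N: "A \<subseteq> {..N}" using assms(1) by (auto simp: finite_nat_set_iff_bounded_le)
  have "(\<Sum>p\<in>A. 1 / ((real p - 1) * real p ^ t)) \<le> (\<Sum>p\<in>A. 2 / 2 ^ t * (1 / (real p * (real p - 1))))"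
    using assms(2) by (intro sum_mono le)
  also have "\<dots> \<le> (\<Sum>p=2..N. 2 / 2 ^ t * (1 / (real p * (real p - 1))))"
    using N assms(2) by (intro sum_mono2) auto
  also have "\<dots> = 2 / 2 ^ t * (\<Sum>p=2..N. 1 / (real p * (real p - 1)))"
    by (simp add: sum_distrib_left)
  also have "\<dots> \<le> 2 / 2 ^ t * 1"
    by (intro mult_left_mono sum_telescope_bound) simp
  finally show ?thesis by simp
qed

text \<open>Induction on \<open>A\<close> with \<open>x + y \<le> x * y\<close> for
  \<open>x, y \<ge> 2\<close>. An empty \<open>A\<close> is split off because its power is only
  1.\<close>

lemma sum_two_powers_le:
  assumes "finite A" "\<And>i. i \<in> A \<Longrightarrow> 1 \<le> e i"
  shows "(\<Sum>i\<in>A. 2 ^ e i) \<le> (2::real) ^ (\<Sum>i\<in>A. e i)"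
  using assms
proof (induction A rule: finite_induct)
  case (insert i A)
  show ?case
  proof (cases "A = {}")
    case False
    then obtain j where "j \<in> A" by blast
    then have "1 \<le> sum e A" using insert.prems insert.hyps(1) by (meson insertI2 le_trans member_le_sum zero_le)
    then have "(2::real) ^ 1 \<le> 2 ^ sum e A" "(2::real) ^ 1 \<le> 2 ^ e i"
      using insert.prems by (intro power_increasing; simp)+
    \<comment> \<open>The right-hand side expands to \<open>x * y - x - y\<close> for the two powers
      \<open>x\<close> and \<open>y\<close>.\<close>
    then have "0 \<le> ((2::real) ^ sum e A - 2) * (2 ^ e i - 2) + (2 ^ sum e A - 2) + (2 ^ e i - 2)"
      by (intro add_nonneg_nonneg mult_nonneg_nonneg) auto
    then have "2 ^ e i + 2 ^ sum e A \<le> (2::real) ^ e i * 2 ^ sum e A"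
      using \<open>(2::real) ^ 1 \<le> 2 ^ sum e A\<close> \<open>(2::real) ^ 1 \<le> 2 ^ e i\<close> by (simp add: algebra_simps)
    with insert show ?thesis by (simp add: power_add)
  qed simp
qed simp

lemma two_power_ge_if_log_le:
  assumes "0 < c" "\<lceil>log 2 c\<rceil> \<le> int t"
  shows "c \<le> 2 ^ t"
proof -
  have "log 2 c \<le> real t" using assms(2) by linarith
  then have "c \<le> 2 powr real t" using assms(1) by (simp add: log_le_iff)
  then show ?thesis by (simp add: powr_realpow)
qed

section \<open>The union bound\<close>

text \<open>The union bound in counting form: a tuple that fails to generate has all its entries in
  some maximal subgroup.\<close>

lemma (in group) order_power_le_generating_tuples:
  assumes fin: "finite (carrier G)"
  shows "order G ^ k \<le> card (generating_tuples G k) + (\<Sum>M | maximal_subgroup M G. card M ^ k)"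
proof -
  let ?L = "\<lambda>A :: 'a set. {xs. set xs \<subseteq> A \<and> length xs = k}"
  let ?Max = "{M. maximal_subgroup M G}"
  have finM: "finite M" if "maximal_subgroup M G" for M
    using that fin by (meson finite_subset maximal_subgroup_def subgroup.subset)
  have finMax: "finite ?Max"
    by (rule finite_subset[of _ "Pow (carrier G)"])
      (auto simp: fin maximal_subgroup_def dest: subgroup.subset)
  have finL: "finite (?L A)" if "finite A" for A
    using that by (rule finite_lists_length_eq)
  have gen: "generating_tuples G k \<subseteq> ?L (carrier G)" by (auto simp: generating_tuples_def)
  have "?L (carrier G) \<subseteq> generating_tuples G k \<union> (\<Union>M\<in>?Max. ?L M)"
  proof
    fix xs assume xs: "xs \<in> ?L (carrier G)"
    show "xs \<in> generating_tuples G k \<union> (\<Union>M\<in>?Max. ?L M)"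
    proof (cases "generate G (set xs) = carrier G")
      case True
      with xs show ?thesis by (simp add: generating_tuples_def)
    next
      case False
      have "subgroup (generate G (set xs)) G" using xs by (intro generate_is_subgroup) blast
      then obtain M where "maximal_subgroup M G" "generate G (set xs) \<subseteq> M"
        using proper_subgroup_in_maximal[OF fin _ False] by blast
      moreover have "set xs \<subseteq> generate G (set xs)" by (blast intro: generate.incl)
      ultimately show ?thesis using xs by blast
    qed
  qed
  then have "card (?L (carrier G)) \<le> card (generating_tuples G k \<union> (\<Union>M\<in>?Max. ?L M))"
    using finMax finM finL finite_subset[OF gen finL[OF fin]] by (intro card_mono) blast+
  also have "\<dots> \<le> card (generating_tuples G k) + (\<Sum>M\<in>?Max. card (?L M))"
    using card_UN_le[OF finMax, of ?L] by (intro order_trans[OF card_Un_le]) simp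
  also have "(\<Sum>M\<in>?Max. card (?L M)) = (\<Sum>M\<in>?Max. card M ^ k)"
    using finM by (intro sum.cong) (auto simp: card_lists_length_eq)
  finally show ?thesis using fin by (simp add: card_lists_length_eq order_def)
qed

text \<open>The number \<open>r p\<close> of generators may depend on the prime, so that the rank
  and the exponent of \<open>p\<close> in the order can both be inserted.\<close>

lemma nilpotent_generation_prob_ge:
  fixes G (structure)
  assumes nil: "nilpotent_group G" and fin: "finite (carrier G)"
    and gens: "\<And>p. p \<in> prime_factors (order G) \<Longrightarrow>
      \<exists>S. S \<subseteq> carrier G \<and> card S \<le> r p \<and> \<not> p dvd order G div card (generate G S)"
    and r: "\<And>p. p \<in> prime_factors (order G) \<Longrightarrow> r p \<le> k"
  shows "1 - (\<Sum>p\<in>prime_factors (order G). 1 / ((real p - 1) * real p ^ (k - r p))) \<le> generation_prob G k"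
proof -
  interpret group G using nil by (simp add: nilpotent_group_def)
  let ?Max = "{M. maximal_subgroup M G}" and ?P = "prime_factors (order G)"
  let ?i = "\<lambda>M. order (G Mod M)"
  let ?N = "\<lambda>p. {M. M \<lhd> G \<and> ?i M = p}"
  have o: "0 < order G" using fin order_gt_0_iff_finite by simp
  have finMax: "finite ?Max"
    by (rule finite_subset[of _ "Pow (carrier G)"])
      (auto simp: fin maximal_subgroup_def dest: subgroup.subset)
  have finN: "finite (?N p)" for p
    by (rule finite_subset[of _ "Pow (carrier G)"])
      (auto simp: fin dest: normal_imp_subgroup subgroup.subset)
  have index: "?i M * card M = order G" if "maximal_subgroup M G" for M
    using lagrange[of M] that by (simp add: maximal_subgroup_def order_def FactGroup_def)
  have prime: "?i M \<in> ?P" if "maximal_subgroup M G" for M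
    using maximal_subgroup_prime_index[OF nil fin that] o dvd_triv_left[of "?i M" "card M"]
    by (simp add: prime_factors_dvd index[OF that])
  have quotient: "real (card M) ^ k / real (order G) ^ k = 1 / real (?i M) ^ k"
    if "maximal_subgroup M G" for M
  proof -
    have "real (order G) = real (?i M) * real (card M)" using index[OF that] by (metis of_nat_mult)
    moreover have "card M \<noteq> 0"
    proof
      assume "card M = 0"
      then show False using index[OF that] o by simp
    qed
    ultimately show ?thesis by (simp add: power_mult_distrib)
  qed
  have bound: "real (card (?N p)) / real p ^ k \<le> 1 / ((real p - 1) * real p ^ (k - r p))"
    if p: "p \<in> ?P" for p
  proof -
    have pr: "Factorial_Ring.prime p" using p by (rule in_prime_factors_imp_prime)
    have p1: "1 < p" using pr by (rule prime_gt_1_nat)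
    obtain S where S: "S \<subseteq> carrier G" "card S \<le> r p" "\<not> p dvd order G div card (generate G S)"
      using gens[OF p] by blast
    have "(p - 1) * card (?N p) < p ^ card S" by (rule card_normal_prime_index[OF fin pr S(1,3)])
    also have "\<dots> \<le> p ^ r p" using S(2) p1 by (intro power_increasing) auto
    finally have "real ((p - 1) * card (?N p)) \<le> real (p ^ r p)" by linarith
    then have le: "(real p - 1) * real (card (?N p)) \<le> real p ^ r p" using p1 by (simp add: of_nat_diff)
    \<comment> \<open>The subtraction on naturals is exact here since
      \<open>r p \<le> k\<close>.\<close>
    have pk: "real p ^ k = real p ^ (k - r p) * real p ^ r p" using r[OF p] by (simp flip: power_add)
    have "real (card (?N p)) \<le> real p ^ r p / (real p - 1)"
      using le p1 by (simp add: pos_le_divide_eq mult.commute)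
    then have "real (card (?N p)) / real p ^ k \<le> real p ^ r p / (real p - 1) / real p ^ k"
      by (intro divide_right_mono) auto
    also have "\<dots> = 1 / ((real p - 1) * real p ^ (k - r p))" using p1 by (simp add: pk)
    finally show ?thesis .
  qed
  have "real (order G ^ k) \<le> real (card (generating_tuples G k) + (\<Sum>M\<in>?Max. card M ^ k))"
    using order_power_le_generating_tuples[OF fin] by (rule of_nat_mono)
  then have "real (order G) ^ k / real (order G) ^ k
      \<le> (real (card (generating_tuples G k)) + (\<Sum>M\<in>?Max. real (card M) ^ k)) / real (order G) ^ k"
    by (intro divide_right_mono) simp_all
  then have "1 \<le> generation_prob G k + (\<Sum>M\<in>?Max. real (card M) ^ k / real (order G) ^ k)"
    using o by (simp add: generation_prob_def add_divide_distrib sum_divide_distrib)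
  also have "(\<Sum>M\<in>?Max. real (card M) ^ k / real (order G) ^ k) = (\<Sum>M\<in>?Max. 1 / real (?i M) ^ k)"
    using quotient by (intro sum.cong) auto
  \<comment> \<open>The maximal subgroups are grouped by their prime index; each group is then
    enlarged to all normal subgroups of that index, whose number is bounded.\<close>
  also have "\<dots> = (\<Sum>p\<in>?P. \<Sum>M | M \<in> ?Max \<and> ?i M = p. 1 / real (?i M) ^ k)"
    using prime by (intro sum.group[symmetric] finMax) auto
  also have "\<dots> \<le> (\<Sum>p\<in>?P. 1 / ((real p - 1) * real p ^ (k - r p)))"
  proof (rule sum_mono)
    fix p assume p: "p \<in> ?P"
    have "(\<Sum>M | M \<in> ?Max \<and> ?i M = p. 1 / real (?i M) ^ k) \<le> (\<Sum>M\<in>?N p. 1 / real (?i M) ^ k)"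
      using finN maximal_subgroup_normal[OF nil] by (intro sum_mono2) auto
    also have "\<dots> = real (card (?N p)) / real p ^ k" by simp
    also have "\<dots> \<le> 1 / ((real p - 1) * real p ^ (k - r p))" by (rule bound[OF p])
    finally show "(\<Sum>M | M \<in> ?Max \<and> ?i M = p. 1 / real (?i M) ^ k) \<le> 1 / ((real p - 1) * real p ^ (k - r p))" .
  qed
  finally show ?thesis by simp
qed

text \<open>A minimal generating set of \<open>G\<close> serves every prime at once, its subgroup
  having index 1, so \<open>r\<close> is constantly the rank.\<close>

lemma nilpotent_generation_prob_rank:
  fixes G (structure)
  assumes nil: "nilpotent_group G"
    and fin: "finite (carrier G)" and k: "group_rank G + t \<le> k" and t: "2 \<le> t"
  shows "1 - 2 / 2 ^ t \<le> generation_prob G k"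
proof -
  interpret group G using nil by (simp add: nilpotent_group_def)
  let ?P = "prime_factors (order G)" and ?d = "group_rank G"
  have o: "0 < order G" using fin order_gt_0_iff_finite by simp
  have "generate G (carrier G) = carrier G"
    by (intro equalityI generate_incl) (auto intro: generate.incl)
  then have "\<exists>n S. S \<subseteq> carrier G \<and> finite S \<and> card S = n \<and> generate G S = carrier G"
    using fin by blast
  then have "\<exists>S. S \<subseteq> carrier G \<and> finite S \<and> card S = ?d \<and> generate G S = carrier G"
    unfolding group_rank_def by (rule LeastI_ex)
  then obtain S where S: "S \<subseteq> carrier G" "card S = ?d" "generate G S = carrier G" by blast
  have "1 - (\<Sum>p\<in>?P. 1 / ((real p - 1) * real p ^ (k - ?d))) \<le> generation_prob G k"
  proof (rule nilpotent_generation_prob_ge[OF nil fin])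
    fix p assume "p \<in> ?P"
    then have "\<not> p dvd 1" by (metis in_prime_factors_imp_prime not_prime_unit)
    then have "\<not> p dvd order G div card (generate G S)" using S(3) o by (simp add: order_def)
    then show "\<exists>S. S \<subseteq> carrier G \<and> card S \<le> ?d \<and> \<not> p dvd order G div card (generate G S)"
      using S by (intro exI[of _ S]) simp
  qed (use k in simp)
  moreover have "(\<Sum>p\<in>?P. 1 / ((real p - 1) * real p ^ (k - ?d))) \<le> 2 / 2 ^ (k - ?d)"
    using k t by (intro sum_primes_bound) (auto intro: prime_ge_2_nat)
  moreover have "2 / 2 ^ (k - ?d) \<le> 2 / (2::real) ^ t"
    using k by (intro divide_left_mono power_increasing) auto
  ultimately show ?thesis by linarith
qed

text \<open>Here \<open>r p\<close> is the exponent of \<open>p\<close> in the order. As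
  \<open>p - 1 \<ge> 1\<close> and \<open>p \<ge> 2\<close>, the term for \<open>p\<close> is at
  most \<open>2 ^ r p / 2 ^ k\<close>, and the exponents add up to the chain length.\<close>

lemma nilpotent_generation_prob_chain_length:
  fixes G (structure)
  assumes nil: "nilpotent_group G"
    and fin: "finite (carrier G)" and k: "chain_length G + t \<le> k"
  shows "1 - 1 / 2 ^ t \<le> generation_prob G k"
proof -
  interpret group G using nil by (simp add: nilpotent_group_def)
  let ?P = "prime_factors (order G)" and ?e = "\<lambda>p. multiplicity p (order G)"
  let ?n = "chain_length G"
  have n: "?n = (\<Sum>p\<in>?P. ?e p)"
    unfolding nilpotent_chain_length[OF nil fin] size_multiset_overloaded_eq
    by (intro sum.cong) (auto simp: count_prime_factorization)
  have en: "?e p \<le> ?n" if "p \<in> ?P" for p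
    unfolding n using that by (intro member_le_sum) auto
  have "1 - (\<Sum>p\<in>?P. 1 / ((real p - 1) * real p ^ (k - ?e p))) \<le> generation_prob G k"
  proof (rule nilpotent_generation_prob_ge[OF nil fin])
    fix p assume p: "p \<in> ?P"
    show "\<exists>S. S \<subseteq> carrier G \<and> card S \<le> ?e p \<and> \<not> p dvd order G div card (generate G S)"
      using sylow_generators[OF fin in_prime_factors_imp_prime[OF p]] by metis
    show "?e p \<le> k" using en[OF p] k by simp
  qed
  moreover have "(\<Sum>p\<in>?P. 1 / ((real p - 1) * real p ^ (k - ?e p))) \<le> (\<Sum>p\<in>?P. 2 ^ ?e p / 2 ^ k)"
  proof (rule sum_mono)
    fix p assume p: "p \<in> ?P"
    then have p2: "2 \<le> real p" using in_prime_factors_imp_prime[OF p] prime_ge_2_nat by fastforce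
    have "(2::real) ^ (k - ?e p) \<le> real p ^ (k - ?e p)" using p2 by (intro power_mono) auto
    then have "1 * 2 ^ (k - ?e p) \<le> (real p - 1) * real p ^ (k - ?e p)"
      using p2 by (intro mult_mono) auto
    then have "1 / ((real p - 1) * real p ^ (k - ?e p)) \<le> 1 / 2 ^ (k - ?e p)"
      by (intro divide_left_mono) (use p2 in auto)
    also have "\<dots> = 2 ^ ?e p / 2 ^ k"
      using en[OF p] k by (simp add: power_diff)
    finally show "1 / ((real p - 1) * real p ^ (k - ?e p)) \<le> 2 ^ ?e p / 2 ^ k" .
  qed
  moreover have "(\<Sum>p\<in>?P. 2 ^ ?e p / (2::real) ^ k) \<le> 2 ^ ?n / 2 ^ k"
    unfolding n sum_divide_distrib[symmetric]
    by (intro divide_right_mono sum_two_powers_le finite_set_mset)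
      (auto simp: prime_factors_multiplicity Suc_le_eq)
  moreover have "2 ^ ?n / 2 ^ k \<le> 1 / (2::real) ^ t"
  proof -
    have "(2::real) ^ ?n * 2 ^ t \<le> 2 ^ k"
      unfolding power_add[symmetric] using k by (intro power_increasing) auto
    then show ?thesis by (simp add: divide_simps)
  qed
  ultimately show ?thesis by linarith
qed

theorem theorem3:
  fixes G :: "('a, 'b) monoid_scheme" and \<epsilon> :: real
  assumes "Group.group G" and "finite (carrier G)" and "nilpotent_group G"
    and "0 < \<epsilon>" and "\<epsilon> < 1"
  shows "(\<forall>k::nat. int k \<ge> int (group_rank G) + \<lceil>log 2 (2 / \<epsilon>)\<rceil>
            \<longrightarrow> generation_prob G k \<ge> 1 - \<epsilon>) \<and>
         (\<forall>k::nat. int k \<ge> int (chain_length G) + \<lceil>log 2 (1 / \<epsilon>)\<rceil>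
            \<longrightarrow> generation_prob G k \<ge> 1 - \<epsilon>)"
proof (intro conjI allI impI)
  fix k :: nat assume k: "int k \<ge> int (group_rank G) + \<lceil>log 2 (2 / \<epsilon>)\<rceil>"
  define t where "t = nat \<lceil>log 2 (2 / \<epsilon>)\<rceil>"
  \<comment> \<open>Since \<epsilon> < 1, the logarithm strictly exceeds 1 and its ceiling is at
    least 2, as the rank estimate requires.\<close>
  have "log 2 2 < log 2 (2 / \<epsilon>)" using assms(4,5) by (subst log_less_cancel_iff) (auto simp: field_simps)
  then have "2 \<le> \<lceil>log 2 (2 / \<epsilon>)\<rceil>" by (simp add: le_ceiling_iff)
  then have t: "2 \<le> t" "int t = \<lceil>log 2 (2 / \<epsilon>)\<rceil>" unfolding t_def by linarith+
  then have "2 / \<epsilon> \<le> 2 ^ t" using assms(4) by (intro two_power_ge_if_log_le) auto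
  then have "2 / 2 ^ t \<le> \<epsilon>" using assms(4) by (simp add: field_simps)
  moreover have "1 - 2 / 2 ^ t \<le> generation_prob G k"
    using k t by (intro nilpotent_generation_prob_rank[OF assms(3,2)]) auto
  ultimately show "generation_prob G k \<ge> 1 - \<epsilon>" by linarith
next
  fix k :: nat assume k: "int k \<ge> int (chain_length G) + \<lceil>log 2 (1 / \<epsilon>)\<rceil>"
  define t where "t = nat \<lceil>log 2 (1 / \<epsilon>)\<rceil>"
  \<comment> \<open>The ceiling is nonnegative, so \<open>nat\<close> in the definition of
    \<open>t\<close> does not truncate it.\<close>
  have "log 2 1 < log 2 (1 / \<epsilon>)" using assms(4,5) by (subst log_less_cancel_iff) (auto simp: field_simps)
  then have "0 \<le> \<lceil>log 2 (1 / \<epsilon>)\<rceil>" by simp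
  then have t: "int t = \<lceil>log 2 (1 / \<epsilon>)\<rceil>" by (simp add: t_def)
  then have "1 / \<epsilon> \<le> 2 ^ t" using assms(4) by (intro two_power_ge_if_log_le) auto
  then have "1 / 2 ^ t \<le> \<epsilon>" using assms(4) by (simp add: field_simps)
  moreover have "1 - 1 / 2 ^ t \<le> generation_prob G k"
    using k t by (intro nilpotent_generation_prob_chain_length[OF assms(3,2)]) auto
  ultimately show "generation_prob G k \<ge> 1 - \<epsilon>" by linarith
qed

end
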